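(* Let $n>17$ be an integer. Then $\gamma^{LD}(C_n(1,3)) = \lceil n/3\rceil$ if $n\equiv 0,1,4\pmod 6$, and $\gamma^{LD}(C_n(1,3)) = \lceil n/3\rceil+1$ otherwise.
   Context: For a positive integer $n$, the circulant graph $C_n(1,3)$ has vertex set $\mathbb{Z}_n$, and $u$ is adjacent to $u\pm1$ and $u\pm 3$ (modulo $n$); $N[u]=\{u,u\pm1,u\pm3\}$. For a code (nonempty subset) $C\subseteq\mathbb{Z}_n$, $I(C;u)=N[u]\cap C$. $C$ is locating-dominating if $I(C;u)\neq\emptyset$ for all vertices $u$ and $I(C;u)\neq I(C;v)$ for all distinct $u,v\in\mathbb{Z}_n\setminus C$. $\gamma^{LD}(G)$ is the minimum cardinality of a locating-dominating code in $G$. *)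

theory Defs
  imports Complex_Main "HOL-Number_Theory.Cong"
begin

text \<open>A graph is given by its vertex set \<open>V\<close> and an adjacency relation \<open>E\<close>.\<close>

definition closed_nbhd :: "'a set \<Rightarrow> ('a \<Rightarrow> 'a \<Rightarrow> bool) \<Rightarrow> 'a \<Rightarrow> 'a set" where
  "closed_nbhd V E u = insert u {v \<in> V. E u v}"

definition identifying_set ::
  "'a set \<Rightarrow> ('a \<Rightarrow> 'a \<Rightarrow> bool) \<Rightarrow> 'a set \<Rightarrow> 'a \<Rightarrow> 'a set" where
  "identifying_set V E C u = closed_nbhd V E u \<inter> C"

definition locating_dominating ::
  "'a set \<Rightarrow> ('a \<Rightarrow> 'a \<Rightarrow> bool) \<Rightarrow> 'a set \<Rightarrow> bool" where
  "locating_dominating V E C \<longleftrightarrow>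
     C \<subseteq> V \<and> C \<noteq> {} \<and>
     (\<forall>u\<in>V. identifying_set V E C u \<noteq> {}) \<and>
     (\<forall>u\<in>V - C. \<forall>v\<in>V - C. u \<noteq> v \<longrightarrow>
        identifying_set V E C u \<noteq> identifying_set V E C v)"

text \<open>Intended for finite nonempty \<open>V\<close>; the minimum is then attained, since \<open>V\<close> itself is
  a locating-dominating code.\<close>

definition gamma_LD :: "'a set \<Rightarrow> ('a \<Rightarrow> 'a \<Rightarrow> bool) \<Rightarrow> nat" where
  "gamma_LD V E = Min (card ` {C. locating_dominating V E C})"

text \<open>\<open>\<int>\<^sub>n\<close> is represented by the residues \<open>0, \<dots>, n - 1\<close>.\<close>

definition circulant_verts :: "nat \<Rightarrow> int set" where
  "circulant_verts n = {0..<int n}"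

definition circulant13_adj :: "nat \<Rightarrow> int \<Rightarrow> int \<Rightarrow> bool" where
  "circulant13_adj n u v \<longleftrightarrow>
     [v = u + 1] (mod int n) \<or> [v = u - 1] (mod int n) \<or>
     [v = u + 3] (mod int n) \<or> [v = u - 3] (mod int n)"

lemma circulant13_adj_sym: "circulant13_adj n u v \<longleftrightarrow> circulant13_adj n v u"
proof -
  have "[v = u + d] (mod int n) \<longleftrightarrow> [u = v - d] (mod int n)" for d
    by (auto simp: cong_iff_dvd_diff algebra_simps dvd_diff_commute)
  from this[of 1] this[of "- 1"] this[of 3] this[of "- 3"] show ?thesis
    unfolding circulant13_adj_def by auto
qed

lemma closed_nbhd_circulant13:
  assumes "u \<in> circulant_verts n"
  shows "closed_nbhd (circulant_verts n) (circulant13_adj n) u =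
    {u, (u + 1) mod int n, (u - 1) mod int n, (u + 3) mod int n, (u - 3) mod int n}"
proof -
  have n: "int n > 0"
    using assms by (auto simp: circulant_verts_def)
  have cong: "[v = w] (mod int n) \<longleftrightarrow> v = w mod int n" if "v \<in> circulant_verts n" for v w
    using that by (auto simp: cong_def circulant_verts_def)
  have mem: "w mod int n \<in> circulant_verts n" for w
    using n by (simp add: circulant_verts_def)
  show ?thesis
    unfolding closed_nbhd_def circulant13_adj_def using cong mem by blast
qed

lemma locating_dominating_verts:
  assumes "V \<noteq> {}"
  shows "locating_dominating V E V"
  using assms by (auto simp: locating_dominating_def identifying_set_def closed_nbhd_def)

lemma gamma_LD_attained:
  assumes "finite V" "V \<noteq> {}"
  shows "\<exists>C. locating_dominating V E C \<and> card C = gamma_LD V E"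
    and "locating_dominating V E C \<Longrightarrow> gamma_LD V E \<le> card C"
proof -
  let ?S = "{C. locating_dominating V E C}"
  have "?S \<subseteq> Pow V"
    by (auto simp: locating_dominating_def)
  hence fin: "finite (card ` ?S)"
    using assms(1) by (meson finite_Pow_iff finite_imageI finite_subset)
  have "V \<in> ?S"
    using locating_dominating_verts[OF assms(2)] by simp
  hence "gamma_LD V E \<in> card ` ?S"
    unfolding gamma_LD_def using fin by (intro Min_in) auto
  thus "\<exists>C. locating_dominating V E C \<and> card C = gamma_LD V E"
    by auto
  show "gamma_LD V E \<le> card C" if "locating_dominating V E C"
    unfolding gamma_LD_def using fin that by (intro Min_le) auto
qed

end

theory Submission
  imports Defs
begin

text \<open>
  Lift a code to an \<open>n\<close>-periodic set of integers. Two vertices can only share a neighbour if they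
  differ by 2, 4 or 6, so being locating-dominating is a condition on windows of 13 consecutive
  integers.

  Upper bound: the periodic word \<open>(110000)\<^sup>k\<close>, with one of the remainders
  \<open>\<epsilon>, 1100100, 11, 110, 1100, 11001\<close> inserted once, satisfies all window conditions.

  Lower bound: windows of length 10 carry a potential such that moving one step to the right costs
  17 times (3 for a codeword, minus 1), up to the difference of the potentials and a nonnegative
  excess. The excess vanishes only as long as the window is a factor of \<open>(110000)\<^sup>\<infinity>\<close>; leaving this
  word costs 18 and every other step costs 1. Summing over a period of length \<open>n \<ge> 18\<close> gives
  \<open>17 (3 |C| - n) \<ge> 18\<close>, hence \<open>3 |C| \<ge> n + 2\<close>, unless the code is \<open>110000\<close> repeated and 6 divides \<open>n\<close>.
\<close>

section \<open>Locating-dominating codes as periodic sets of integers\<close>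

definition adj13 :: "int \<Rightarrow> int \<Rightarrow> bool" where
  "adj13 u v \<longleftrightarrow> v - u \<in> {-3, -1, 1, 3}"

definition dominated :: "(int \<Rightarrow> bool) \<Rightarrow> int \<Rightarrow> bool" where
  "dominated x u \<longleftrightarrow> x u \<or> (\<exists>w. x w \<and> adj13 u w)"

text \<open>Plain adjacency suffices in the last disjunct: it matters only if neither vertex is a
  codeword, and then neither lies in its own identifying set.\<close>

definition separated :: "(int \<Rightarrow> bool) \<Rightarrow> int \<Rightarrow> int \<Rightarrow> bool" where
  "separated x u v \<longleftrightarrow> x u \<or> x v \<or> (\<exists>w. x w \<and> adj13 u w \<noteq> adj13 v w)"

definition locally_ld :: "(int \<Rightarrow> bool) \<Rightarrow> bool" where
  "locally_ld x \<longleftrightarrow> (\<forall>u. dominated x u) \<and> (\<forall>u. \<forall>d\<in>{2, 4, 6}. separated x u (u + d))"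

lemma dominated_iff:
  "dominated x u \<longleftrightarrow> x (u - 3) \<or> x (u - 1) \<or> x u \<or> x (u + 1) \<or> x (u + 3)"
proof -
  have "adj13 u w \<longleftrightarrow> w \<in> {u - 3, u - 1, u + 1, u + 3}" for w
    unfolding adj13_def by auto
  then show ?thesis
    unfolding dominated_def by auto
qed

text \<open>The neighbourhoods of \<open>u\<close> and \<open>u + d\<close> share three, two or one
  vertices for \<open>d\<close> = 2, 4, 6, so only two, four or six neighbours are left to tell the
  vertices apart.\<close>

lemma separated_2:
  "separated x u (u + 2) \<longleftrightarrow> x (u - 3) \<or> x u \<or> x (u + 2) \<or> x (u + 5)"
proof -
  have "adj13 u w \<noteq> adj13 (u + 2) w \<longleftrightarrow> w \<in> {u - 3, u + 5}" for w
    unfolding adj13_def by auto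
  then show ?thesis
    unfolding separated_def by auto
qed

lemma separated_4:
  "separated x u (u + 4) \<longleftrightarrow> x (u - 3) \<or> x (u - 1) \<or> x u \<or> x (u + 4) \<or> x (u + 5) \<or> x (u + 7)"
proof -
  have "adj13 u w \<noteq> adj13 (u + 4) w \<longleftrightarrow> w \<in> {u - 3, u - 1, u + 5, u + 7}" for w
    unfolding adj13_def by auto
  then show ?thesis
    unfolding separated_def by auto
qed

lemma separated_6:
  "separated x u (u + 6) \<longleftrightarrow> x (u - 3) \<or> x (u - 1) \<or> x u \<or> x (u + 1) \<or>
    x (u + 5) \<or> x (u + 6) \<or> x (u + 7) \<or> x (u + 9)"
proof -
  have "adj13 u w \<noteq> adj13 (u + 6) w \<longleftrightarrow> w \<in> {u - 3, u - 1, u + 1, u + 5, u + 7, u + 9}" for w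
    unfolding adj13_def by auto
  then show ?thesis
    unfolding separated_def by auto
qed

section \<open>Passing from residues to integers\<close>

lemma identifying_set_circulant13:
  assumes "n > 0"
  shows "identifying_set (circulant_verts n) (circulant13_adj n) C (u mod int n) =
    (\<lambda>w. w mod int n) ` {w. (w = u \<or> adj13 u w) \<and> w mod int n \<in> C}"
proof -
  have "u mod int n \<in> circulant_verts n"
    using assms by (simp add: circulant_verts_def)
  then have "closed_nbhd (circulant_verts n) (circulant13_adj n) (u mod int n) =
      (\<lambda>w. w mod int n) ` {u, u + 1, u - 1, u + 3, u - 3}"
    by (simp add: closed_nbhd_circulant13 mod_simps)
  moreover have "{u, u + 1, u - 1, u + 3, u - 3} = {w. w = u \<or> adj13 u w}"
    unfolding adj13_def by auto
  ultimately show ?thesis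
    unfolding identifying_set_def by auto
qed

lemma cong_eq_if_close:
  fixes a b :: int
  assumes "a mod int n = b mod int n" "\<bar>a - b\<bar> < int n"
  shows "a = b"
  using assms by (metis abs_of_nat dvd_imp_le_int linorder_not_le mod_eq_dvd_iff
      right_minus_eq)

text \<open>Reduction modulo \<open>n\<close> is injective on the short ranges involved, so
  comparing identifying sets of residues amounts to comparing neighbourhoods of integers. Equal
  nonempty identifying sets of two non-codewords contain a common neighbour, which brings suitable
  representatives within distance 6.\<close>

lemma locating_dominating_iff_locally_ld:
  fixes n :: nat
  assumes n: "n > 12" and C: "C \<subseteq> circulant_verts n"
  defines "x \<equiv> \<lambda>i. i mod int n \<in> C"
  shows "locating_dominating (circulant_verts n) (circulant13_adj n) C \<longleftrightarrow> locally_ld x"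
proof -
  let ?V = "circulant_verts n"
  let ?I = "\<lambda>u. identifying_set ?V (circulant13_adj n) C (u mod int n)"
  have n0: "n > 0" using n by simp
  have I: "?I u = (\<lambda>w. w mod int n) ` {w. (w = u \<or> adj13 u w) \<and> x w}" for u
    using identifying_set_circulant13[OF n0] by (simp add: x_def)
  have V: "u mod int n \<in> ?V" for u
    using n0 by (simp add: circulant_verts_def)
  have mod_V: "u mod int n = u" if "u \<in> ?V" for u
    using that by (simp add: circulant_verts_def)
  have dom: "?I u \<noteq> {} \<longleftrightarrow> dominated x u" for u
    unfolding I dominated_def by auto
  have in_I: "w mod int n \<in> ?I v \<longleftrightarrow> adj13 v w"
    if w: "x w" "\<not> x v" "\<bar>w - v\<bar> \<le> 9" for v w
  proof
    assume "w mod int n \<in> ?I v"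
    then obtain w' where w': "w mod int n = w' mod int n" "adj13 v w'"
      unfolding I using w(2) by auto
    \<comment> \<open>The distances add up to at most 9 + 3 = 12, which explains the bound on
      \<open>n\<close>. The 9 is 6 + 3: a neighbour of one vertex of the pair seen from the
      other.\<close>
    have "\<bar>w - w'\<bar> < int n"
      using w(3) w'(2) n unfolding adj13_def by auto
    then show "adj13 v w"
      using cong_eq_if_close[OF w'(1)] w'(2) by simp
  next
    assume "adj13 v w"
    then show "w mod int n \<in> ?I v"
      unfolding I using w(1) by auto
  qed
  have sep: "?I u \<noteq> ?I (u + d) \<longleftrightarrow> separated x u (u + d)"
    if ud: "\<not> x u" "\<not> x (u + d)" "d \<in> {2, 4, 6}" for u d
  proof
    assume "separated x u (u + d)"
    then obtain w where w: "x w" "adj13 u w \<noteq> adj13 (u + d) w"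
      using ud unfolding separated_def by auto
    have "\<bar>w - u\<bar> \<le> 9" "\<bar>w - (u + d)\<bar> \<le> 9"
      using w(2) ud(3) unfolding adj13_def by auto
    then show "?I u \<noteq> ?I (u + d)"
      using in_I[OF w(1) ud(1)] in_I[OF w(1) ud(2)] w(2) by blast
  next
    assume "?I u \<noteq> ?I (u + d)"
    then show "separated x u (u + d)"
      unfolding I separated_def using ud(1,2) by auto
  qed
  show ?thesis
  proof
    assume ld: "locating_dominating ?V (circulant13_adj n) C"
    have "dominated x u" for u
      using ld V dom unfolding locating_dominating_def by blast
    moreover have "separated x u (u + d)" if d: "d \<in> {2, 4, 6}" for u d
    proof (cases "x u \<or> x (u + d)")
      case True
      then show ?thesis unfolding separated_def by auto
    next
      case False
      have "u mod int n \<noteq> (u + d) mod int n"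
        using cong_eq_if_close[of u n "u + d"] d n by auto
      then have "?I u \<noteq> ?I (u + d)"
        using ld V False unfolding locating_dominating_def x_def by blast
      then show ?thesis using sep[OF _ _ d] False by blast
    qed
    ultimately show "locally_ld x"
      unfolding locally_ld_def by blast
  next
    assume ld: "locally_ld x"
    have ne: "?I u \<noteq> {}" for u
      using ld dom unfolding locally_ld_def by blast
    have close: "?I u \<noteq> ?I (u + d)" if "\<not> x u" "\<not> x (u + d)" "d \<in> {-6, -4, -2, 2, 4, 6}" for u d
    proof (cases "d > 0")
      case True
      then show ?thesis
        using sep[of u d] that ld unfolding locally_ld_def by auto
    next
      case False
      then have "- d \<in> {2, 4, 6}" using that(3) by auto
      then have "separated x (u + d) (u + d + - d)"
        using ld unfolding locally_ld_def by blast
      then show ?thesis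
        using sep[of "u + d" "- d"] that(1,2) \<open>- d \<in> {2, 4, 6}\<close> by simp
    qed
    have "identifying_set ?V (circulant13_adj n) C u \<noteq> identifying_set ?V (circulant13_adj n) C v"
      if u: "u \<in> ?V - C" and v: "v \<in> ?V - C" and uv: "u \<noteq> v" for u v
    proof
      assume eq: "identifying_set ?V (circulant13_adj n) C u = identifying_set ?V (circulant13_adj n) C v"
      have xu: "\<not> x u" "\<not> x v" and m: "u mod int n = u" "v mod int n = v"
        using u v mod_V unfolding x_def by auto
      have eqI: "?I u = ?I v" using eq m by simp
      obtain w where w: "adj13 u w" "x w"
        using ne[of u] xu(1) unfolding I by auto
      then have "w mod int n \<in> ?I v"
        unfolding eqI[symmetric] unfolding I by auto
      then obtain w' where w': "adj13 v w'" "w mod int n = w' mod int n"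
        unfolding I using xu(2) by auto
      \<comment> \<open>\<open>u + d\<close> is the representative of \<open>v\<close> modulo
        \<open>n\<close> that has \<open>w\<close> as a neighbour in common with
        \<open>u\<close>.\<close>
      define d where "d = (w - u) - (w' - v)"
      have "(u + d) mod int n = (v + w - w') mod int n"
        unfolding d_def by (simp add: algebra_simps)
      also have "\<dots> = v mod int n"
        using w'(2) by (metis add_diff_cancel_right' diff_add_eq mod_diff_cong)
      finally have ud: "(u + d) mod int n = v mod int n" .
      have "d \<in> {-6, -4, -2, 0, 2, 4, 6}"
        using w(1) w'(1) unfolding d_def adj13_def by auto
      moreover have "d \<noteq> 0" using ud m uv by auto
      moreover have "\<not> x (u + d)" using ud xu(2) unfolding x_def by simp
      ultimately have "?I u \<noteq> ?I (u + d)"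
        using close xu(1) by auto
      then show False using eqI ud by simp
    qed
    moreover have "C \<noteq> {}"
      using ne[of 0] unfolding identifying_set_def by auto
    moreover have "identifying_set ?V (circulant13_adj n) C u \<noteq> {}" if "u \<in> ?V" for u
      using ne[of u] mod_V[OF that] by simp
    ultimately show "locating_dominating ?V (circulant13_adj n) C"
      unfolding locating_dominating_def using C by blast
  qed
qed

section \<open>The lower bound\<close>

text \<open>Arguments are listed from the newest (rightmost) bit to the oldest one. The values are a feasible
  potential (shortest-path distances) for the graph of admissible windows, found by computer.\<close>

definition potential ::
  "bool \<Rightarrow> bool \<Rightarrow> bool \<Rightarrow> bool \<Rightarrow> bool \<Rightarrow> bool \<Rightarrow> bool \<Rightarrow> bool \<Rightarrow> bool \<Rightarrow> bool \<Rightarrow> int" where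
  "potential a b c d e f g h i j =
    (if a then (if b then (if c then (if d then 114 else (if e then 114 else (if f then 114
     else (if g then 114 else 99)))) else (if d then 102 else (if e then 102 else (if f then
     (if g then (if h then 111 else 90) else (if h then 99 else 84)) else (if g then (if h
     then (if i then 108 else (if j then 96 else 95)) else 66) else (if h then 78 else
     72)))))) else (if c then (if d then 93 else (if e then (if f then 108 else (if g then 99
     else 84)) else (if f then 87 else (if g then 93 else 69)))) else (if d then (if e then 75
     else (if f then 84 else (if g then (if h then 72 else 69) else 72))) else (if e then (if
     f then (if g then 78 else (if h then 81 else (if i then 81 else (if j then 78 else 57))))
     else (if g then 66 else 51)) else (if f then (if g then (if h then 75 else (if i then 63
     else (if j then 63 else 61))) else (if h then 54 else 33)) else (if g then 45 else
     39)))))) else (if b then (if c then (if d then (if e then 96 else (if f then 96 else (if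
     g then 96 else (if h then 96 else 81)))) else (if e then 84 else (if f then 84 else (if g
     then (if h then 93 else 81) else (if h then (if i then (if j then 90 else 78) else (if j
     then 90 else 78)) else 60))))) else (if d then (if e then 75 else (if f then (if g then
     90 else (if h then 81 else 66)) else (if g then 69 else (if h then 75 else 51)))) else
     (if e then (if f then 57 else 54) else (if f then 60 else (if g then (if h then 57 else
     36) else (if h then 57 else 36)))))) else (if c then (if d then (if e then (if f then 78
     else (if g then 78 else (if h then 78 else (if i then 78 else 63)))) else (if f then 66
     else (if g then 66 else (if h then (if i then 75 else 63) else (if i then 61 else 42)))))
     else (if e then (if f then 57 else (if g then 63 else 51)) else (if f then (if g then 39
     else 36) else 39))) else (if d then (if e then (if f then (if g then 60 else (if h then
     60 else (if i then 60 else (if j then 60 else 45)))) else (if g then 48 else (if h then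
     48 else (if i then (if j then 57 else 45) else (if j then 44 else 24))))) else (if f then
     (if g then 39 else (if h then 45 else 33)) else 18)) else (if e then (if f then (if g
     then 42 else (if h then 30 else (if i then 30 else (if j then 39 else 27)))) else (if g
     then 21 else 0)) else (if f then (if g then (if h then 24 else 12) else (if h then 24
     else 12)) else 6))))))"

text \<open>The six phases of the word \<open>110000\<close> repeated, cut to length 11. This set is
  closed under reversal, so the newest-first order does no harm.\<close>

definition tight_windows :: "bool list set" where
  "tight_windows =
    {[True, True, False, False, False, False, True, True, False, False, False],
     [True, False, False, False, False, True, True, False, False, False, False],
     [False, False, False, False, True, True, False, False, False, False, True],
     [False, False, False, True, True, False, False, False, False, True, True],
     [False, False, True, True, False, False, False, False, True, True, False],
     [False, True, True, False, False, False, False, True, True, False, False]}"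

text \<open>The second case is a step that leaves the periodic word: the ten older bits, but not all eleven,
  fit it.\<close>

definition excess :: "bool list \<Rightarrow> int" where
  "excess w =
    (if w \<in> tight_windows then 0 else if tl w \<in> tl ` tight_windows then 18 else 1)"

text \<open>The hypotheses are the conditions that fit into eleven consecutive positions: domination
  of five vertices, separation of three pairs at distance 2 and of one pair at distance 4. What
  remains is a finite check; simplifying after each case split prunes inadmissible windows
  early.\<close>

lemma potential_step:
  assumes "a \<or> c \<or> d \<or> e \<or> g" "b \<or> d \<or> e \<or> f \<or> h" "c \<or> e \<or> f \<or> g \<or> i"
    and "d \<or> f \<or> g \<or> h \<or> j" "e \<or> g \<or> h \<or> i \<or> k"
    and "a \<or> d \<or> f \<or> i" "b \<or> e \<or> g \<or> j" "c \<or> f \<or> h \<or> k"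
    and "a \<or> c \<or> d \<or> h \<or> i \<or> k"
  shows "potential a b c d e f g h i j + excess [a, b, c, d, e, f, g, h, i, j, k] \<le>
    potential b c d e f g h i j k + 17 * (3 * of_bool a - 1)"
  using assms unfolding potential_def excess_def tight_windows_def
  by (cases a; simp; cases b; simp; cases c; simp?; cases d; simp?; cases e; simp?; cases f; simp?;
      cases g; simp?; cases h; simp?; cases i; simp?; cases j; simp?; cases k; simp?)

definition window :: "(int \<Rightarrow> bool) \<Rightarrow> int \<Rightarrow> bool list" where
  "window x i = [x i, x (i - 1), x (i - 2), x (i - 3), x (i - 4), x (i - 5), x (i - 6),
     x (i - 7), x (i - 8), x (i - 9), x (i - 10)]"

lemma locally_ld_potential:
  assumes "locally_ld x"
  defines "p \<equiv> \<lambda>i. potential (x i) (x (i - 1)) (x (i - 2)) (x (i - 3)) (x (i - 4))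
    (x (i - 5)) (x (i - 6)) (x (i - 7)) (x (i - 8)) (x (i - 9))"
  shows "p i + excess (window x i) \<le> p (i - 1) + 17 * (3 * of_bool (x i) - 1)"
proof -
  have "dominated x u" "separated x u (u + 2)" "separated x u (u + 4)" for u
    using assms(1) unfolding locally_ld_def by auto
  note dom = this(1)[unfolded dominated_iff] and sep = this(2)[unfolded separated_2]
    and sep4 = this(3)[unfolded separated_4]
  have shift: "p (i - 1) = potential (x (i - 1)) (x (i - 2)) (x (i - 3)) (x (i - 4))
    (x (i - 5)) (x (i - 6)) (x (i - 7)) (x (i - 8)) (x (i - 9)) (x (i - 10))"
    unfolding p_def by simp
  show ?thesis
    unfolding shift unfolding p_def window_def
  proof (rule potential_step)
    show "x i \<or> x (i - 2) \<or> x (i - 3) \<or> x (i - 4) \<or> x (i - 6)"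
      using dom[of "i - 3"] by auto
    show "x (i - 1) \<or> x (i - 3) \<or> x (i - 4) \<or> x (i - 5) \<or> x (i - 7)"
      using dom[of "i - 4"] by auto
    show "x (i - 2) \<or> x (i - 4) \<or> x (i - 5) \<or> x (i - 6) \<or> x (i - 8)"
      using dom[of "i - 5"] by auto
    show "x (i - 3) \<or> x (i - 5) \<or> x (i - 6) \<or> x (i - 7) \<or> x (i - 9)"
      using dom[of "i - 6"] by auto
    show "x (i - 4) \<or> x (i - 6) \<or> x (i - 7) \<or> x (i - 8) \<or> x (i - 10)"
      using dom[of "i - 7"] by auto
    show "x i \<or> x (i - 3) \<or> x (i - 5) \<or> x (i - 8)"
      using sep[of "i - 5"] by auto
    show "x (i - 1) \<or> x (i - 4) \<or> x (i - 6) \<or> x (i - 9)"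
      using sep[of "i - 6"] by auto
    show "x (i - 2) \<or> x (i - 5) \<or> x (i - 7) \<or> x (i - 10)"
      using sep[of "i - 7"] by auto
    show "x i \<or> x (i - 2) \<or> x (i - 3) \<or> x (i - 7) \<or> x (i - 8) \<or> x (i - 10)"
      using sep4[of "i - 7"] by auto
  qed
qed

section \<open>Windows that follow or leave the periodic word\<close>

lemma excess_nonneg: "excess w \<ge> 0"
  by (simp add: excess_def)

text \<open>The ten newest bits of a tight window are again a factor of the periodic word, so the
  next step either continues this word or leaves it; the generic cost 1 cannot occur.\<close>

lemma excess_after_tight:
  assumes "window x (i - 1) \<in> tight_windows"
  shows "excess (window x i) \<in> {0, 18}"
proof -
  have "tl (window x i) = butlast (window x (i - 1))"
    by (simp add: window_def)
  moreover have "butlast w \<in> tl ` tight_windows" if "w \<in> tight_windows" for w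
    using that by (auto simp: tight_windows_def)
  ultimately have "tl (window x i) \<in> tl ` tight_windows"
    using assms by simp
  then show ?thesis
    by (simp add: excess_def)
qed

text \<open>If every window is tight, the whole sequence is \<open>110000\<close> repeated. Both 6
  and \<open>n\<close> are periods, hence so is \<open>n mod 6\<close>, and no nonzero shift below 6
  preserves this word.\<close>

lemma tight_windows_period:
  assumes tight: "\<And>i. window x i \<in> tight_windows" and per: "\<And>i. x (i + int n) = x i"
  shows "6 dvd n"
proof -
  have six: "x (i - 6) = x i" for i
    using tight[of i] by (auto simp: tight_windows_def window_def)
  have "\<exists>i. x i \<and> \<not> x (i - 1)"
  proof (rule ccontr)
    assume "\<nexists>i. x i \<and> \<not> x (i - 1)"
    then have step: "x i \<Longrightarrow> x (i - 1)" for i by blast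
    show False
      using tight[of 0] step[of 0] step[of "-1"] step[of "-2"] step[of "-3"] step[of "-4"] step[of "-5"]
        step[of "-6"] step[of "-7"] step[of "-8"] step[of "-9"]
      by (simp add: tight_windows_def window_def) blast
  qed
  \<comment> \<open>\<open>p\<close> is the first position of a run \<open>11\<close>; it fixes the
    phase, and each nonzero shift is refuted near it.\<close>
  then obtain p where p: "x p" "\<not> x (p - 1)" by blast
  have down: "x (i - 6 * int k) = x i" for i k
  proof (induction k)
    case (Suc k)
    then show ?case using six[of "i - 6 * int k"] by (simp add: algebra_simps)
  qed simp
  have "x (i + int n - 6 * int (n div 6)) = x i" for i
    using down[of "i + int n" "n div 6"] per[of i] by simp
  moreover have "int n - 6 * int (n div 6) = int (n mod 6)"
    by (simp add: zmod_int zdiv_int minus_mult_div_eq_mod)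
  ultimately have r: "x (i + int (n mod 6)) = x i" for i
    by (simp add: algebra_simps)
  have "n mod 6 < 6" by simp
  then consider "n mod 6 = 0" | "n mod 6 = 1" | "n mod 6 = 2" | "n mod 6 = 3" | "n mod 6 = 4" | "n mod 6 = 5"
    by linarith
  then show ?thesis
  proof cases
    case 1 then show ?thesis by auto
  next
    case 2 then show ?thesis using r[of "p - 1"] p by simp
  next
    case 3 then show ?thesis 
      using tight[of p] p r[of "p"] r[of "p - 1"] r[of "p - 2"] r[of "p - 3"] 
      by (simp add: tight_windows_def window_def)
  next
    case 4 then show ?thesis 
      using tight[of p] p r[of "p"] r[of "p - 1"] r[of "p - 2"] r[of "p - 3"] 
      by (simp add: tight_windows_def window_def)
  next
    case 5 then show ?thesis 
      using tight[of p] p r[of "p - 4"] r[of "p - 1"] r[of "p - 5"] r[of "p - 6"] 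
      by (simp add: tight_windows_def window_def)
  next
    case 6 then show ?thesis 
      using tight[of p] p r[of "p"] r[of "p - 1"] r[of "p - 5"] r[of "p - 6"] 
      by (simp add: tight_windows_def window_def)
  qed
qed

text \<open>Summed over one period, the potential differences cancel, so 17 (3 |C| - n) is at least
  the total excess, where |C| counts the codewords in a period.\<close>

lemma periodic_card_ge:
  fixes n :: nat
  assumes ld: "locally_ld x" and per: "\<And>i. x (i + int n) = x i"
    and n: "n > 17"
  shows "n + (if 6 dvd n then 0 else 2) \<le> 3 * card {i. i < n \<and> x (int i)}"
proof -
  define p where "p i = potential (x i) (x (i - 1)) (x (i - 2)) (x (i - 3)) (x (i - 4))
    (x (i - 5)) (x (i - 6)) (x (i - 7)) (x (i - 8)) (x (i - 9))" for i
  define e where "e i = excess (window x i)" for i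
  have per': "x (i + int n - k) = x (i - k)" for i k
    using per[of "i - k"] by (simp add: algebra_simps)
  have p_per: "p (i + int n) = p i" for i
    unfolding p_def by (simp add: per per')
  have w_per: "window x (i + int n) = window x i" for i
    unfolding window_def by (simp add: per per')
  have w_mod: "window x (i mod int n) = window x i" for i
  proof -
    have *: "window x (j + int n * int k) = window x j" for j k
    proof (induction k)
      case (Suc k)
      then show ?case using w_per[of "j + int n * int k"] by (simp add: algebra_simps)
    qed simp
    show ?thesis
    proof (cases "i div int n \<ge> 0")
      case True
      then show ?thesis using *[of "i mod int n" "nat (i div int n)"] by simp
    next
      case False
      then show ?thesis using *[of i "nat (- (i div int n))"]
        by (simp add: minus_mult_div_eq_mod algebra_simps)
    qed
  qed
  have "(\<Sum>i<n. e (int i)) \<ge> 18" if "\<not> 6 dvd n"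
  \<comment> \<open>A single departure from the periodic word already pays 18. Without one,
    tightness persists to the right; hence either all windows are tight, which forces 6 to divide
    \<open>n\<close>, or none is and each of the \<open>n\<close> windows costs 1.\<close>
  proof (cases "\<exists>i. e i = 18")
    case True
    then obtain i where "e i = 18" by blast
    then have "e (int (nat (i mod int n))) = 18"
      using n w_mod unfolding e_def by simp
    moreover have "nat (i mod int n) < n"
      using n by (simp add: nat_less_iff)
    ultimately show ?thesis
      using member_le_sum[of "nat (i mod int n)" "{..<n}" "\<lambda>i. e (int i)"] excess_nonneg
      unfolding e_def by auto
  next
    case no: False
    have fwd: "window x (i + int k) \<in> tight_windows" if "window x i \<in> tight_windows" for i k
    proof (induction k)
      case (Suc k)
      then have "e (i + int (Suc k)) \<in> {0, 18}"
        using excess_after_tight[of x "i + int (Suc k)"] unfolding e_def by simp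
      then have "e (i + int (Suc k)) = 0" using no by auto
      then show ?case unfolding e_def excess_def by (simp split: if_splits)
    qed (use that in simp)
    have none: "window x i \<notin> tight_windows" for i
    proof
      assume i: "window x i \<in> tight_windows"
      have "window x j \<in> tight_windows" for j
      proof -
        \<comment> \<open>By periodicity, every position is reached from \<open>i\<close> by forward
          steps only.\<close>
        have *: "window x j = window x (i + int (nat ((j - i) mod int n)))"
          using n w_mod[of j] w_mod[of "i + (j - i) mod int n"] by (simp add: mod_simps)
        show ?thesis unfolding * by (rule fwd[OF i])
      qed
      then show False using tight_windows_period per \<open>\<not> 6 dvd n\<close> by blast
    qed
    have "e i = 1" for i
    proof -
      have "e i \<noteq> 18" using no by blast
      then show ?thesis
        using none[of i] unfolding e_def excess_def by (simp split: if_splits)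
    qed
    then show ?thesis using n by simp
  qed
  moreover have "(\<Sum>i<n. e (int i)) \<ge> 0"
    using excess_nonneg unfolding e_def by (intro sum_nonneg) auto
  ultimately have "(if 6 dvd n then 0 else 18) \<le> (\<Sum>i<n. e (int i))"
    by simp
  moreover have "(\<Sum>i<n. e (int i)) \<le> (\<Sum>i<n. 17 * (3 * of_bool (x (int i)) - 1) + (p (int i - 1) - p (int i)))"
    using locally_ld_potential[OF ld] unfolding p_def e_def
    by (intro sum_mono) (simp add: algebra_simps)
  moreover have "(\<Sum>i<n. p (int i - 1) - p (int i)) = 0"
  proof -
    have "(\<Sum>i<n. p (int i - 1) - p (int i)) = - (\<Sum>i<n. p (int (Suc i) - 1) - p (int i - 1))"
      by (simp add: sum_subtractf)
    also have "(\<Sum>i<n. p (int (Suc i) - 1) - p (int i - 1)) = p (int n - 1) - p (- 1)"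
      by (subst sum_lessThan_telescope) simp
    finally show ?thesis using p_per[of "- 1"] by simp
  qed
  moreover have "(\<Sum>i<n. 17 * (3 * of_bool (x (int i)) - 1)) =
      17 * (3 * int (card {i. i < n \<and> x (int i)}) - int n)"
  proof -
    have "{..<n} \<inter> {i. x (int i)} = {i. i < n \<and> x (int i)}" by auto
    then have "(\<Sum>i<n. of_bool (x (int i))) = int (card {i. i < n \<and> x (int i)})"
      by (simp add: sum_of_bool_eq)
    then show ?thesis
      by (simp add: sum_subtractf flip: sum_distrib_left)
  qed
  ultimately have "(if 6 dvd n then 0 else 18) \<le> 17 * (3 * int (card {i. i < n \<and> x (int i)}) - int n)"
    by (simp only: sum.distrib)
  \<comment> \<open>Since 18 exceeds 17, the integer 3 c - n must be at least 2, not just 1.\<close>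
  moreover have "(if 6 dvd n then 0 else 18) \<le> 17 * (3 * int c - int n) \<Longrightarrow>
      n + (if 6 dvd n then 0 else 2) \<le> 3 * c" for c :: nat
    by (cases "6 dvd n") auto
  ultimately show ?thesis by blast
qed

section \<open>The upper bound\<close>

definition block :: "bool list" where
  "block = [True, True, False, False, False, False]"

text \<open>For the window starting at \<open>u - 3\<close>: \<open>u\<close> (the entry \<open>d\<close>) is dominated, and separated from \<open>u + 2\<close>,
  \<open>u + 4\<close> and \<open>u + 6\<close>.\<close>

fun locally_ld_window :: "bool list \<Rightarrow> bool" where
  "locally_ld_window [a, b, c, d, e, f, g, h, i, j, k, l, m] \<longleftrightarrow>
    (a \<or> c \<or> d \<or> e \<or> g) \<and> (a \<or> d \<or> f \<or> i) \<and> (a \<or> c \<or> d \<or> h \<or> i \<or> k) \<and>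
    (a \<or> c \<or> d \<or> e \<or> i \<or> j \<or> k \<or> m)"
| "locally_ld_window w \<longleftrightarrow> False"

lemma locally_ldI:
  assumes "\<And>s. locally_ld_window (map (\<lambda>d. x (s + int d)) [0..<13])"
  shows "locally_ld x"
proof -
  have *: "locally_ld_window [x (u - 3), x (u - 2), x (u - 1), x u, x (u + 1), x (u + 2),
      x (u + 3), x (u + 4), x (u + 5), x (u + 6), x (u + 7), x (u + 8), x (u + 9)]" for u
    using assms[of "u - 3"] by (simp add: upt_rec numeral_eq_Suc algebra_simps)
  show ?thesis
    unfolding locally_ld_def using *
    by (auto simp: dominated_iff separated_2 separated_4 separated_6)
qed

section \<open>Cyclic words made of a remainder and blocks\<close>

definition extend :: "bool list \<Rightarrow> nat \<Rightarrow> bool list" where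
  "extend w k = w @ concat (replicate k block)"

lemma length_extend: "length (extend w k) = length w + 6 * k"
  by (simp add: extend_def block_def length_concat sum_list_replicate)

lemma nth_concat_replicate:
  assumes "q < k * length b"
  shows "concat (replicate k b) ! q = b ! (q mod length b)"
  using assms
proof (induction k arbitrary: q)
  case (Suc k)
  show ?case
  proof (cases "q < length b")
    case False
    then show ?thesis
      using Suc.IH[of "q - length b"] Suc.prems by (simp add: nth_append le_mod_geq)
  qed (simp add: nth_append)
qed simp

definition cyclic :: "bool list \<Rightarrow> int \<Rightarrow> bool" where
  "cyclic w i = w ! nat (i mod int (length w))"

lemma cyclic_of_nat: "cyclic w (int j) = w ! (j mod length w)"
  by (simp add: cyclic_def nat_mod_distrib flip: of_nat_mod)

lemma cyclic_mod: "cyclic w (i mod int (length w)) = cyclic w i"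
  by (simp add: cyclic_def)

lemma length_block [simp]: "length block = 6"
  by (simp add: block_def)

text \<open>Three blocks have 18 = 5 + 13 entries, so a window of length 13 fits into them at each
  of the six phases.\<close>

definition padded :: "bool list \<Rightarrow> bool list" where
  "padded w = concat (replicate 3 block) @ w @ concat (replicate 3 block)"

lemma nth_padded_low: "j < 18 \<Longrightarrow> padded w ! j = block ! (j mod 6)"
  using nth_concat_replicate[of j 3 block]
  by (simp add: padded_def nth_append length_concat sum_list_replicate)

lemma nth_padded_high:
  assumes "j < length w + 18"
  shows "padded w ! (18 + j) = (if j < length w then w ! j else block ! ((j - length w) mod 6))"
  using assms nth_concat_replicate[of "j - length w" 3 block]
  by (simp add: padded_def nth_append length_concat sum_list_replicate)

lemma length_padded [simp]: "length (padded w) = length w + 36"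
  by (simp add: padded_def length_concat sum_list_replicate)

text \<open>Three blocks on both sides are enough to see every window of the cyclic word, in whatever
  number of blocks the remainder is inserted.\<close>

lemma window_extend_in_padded:
  fixes w :: "bool list" and k :: nat
  defines "n \<equiv> length w + 6 * k"
  assumes k: "k \<ge> 2" and m: "m < n"
  shows "\<exists>t. t + 13 \<le> length (padded w) \<and>
    (\<forall>d<13. cyclic (extend w k) (int (m + d)) = padded w ! (t + d))"
proof -
  let ?a = "length w"
  have n: "length (extend w k) = n" by (simp add: length_extend n_def)
  define c where "c j = cyclic (extend w k) (int j)" for j
  have low: "c j = w ! j" if "j < ?a" for j
    using that by (simp add: c_def cyclic_of_nat n n_def) (simp add: extend_def nth_append)
  have high: "c j = block ! ((j - ?a) mod 6)" if "?a \<le> j" "j < n" for j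
  proof -
    have "concat (replicate k block) ! (j - ?a) = block ! ((j - ?a) mod length block)"
      using that by (intro nth_concat_replicate) (simp add: n_def)
    then show ?thesis
      using that by (simp add: c_def cyclic_of_nat n) (simp add: extend_def nth_append)
  qed
  have wrap: "c j = c (j - n)" if "n \<le> j" for j
    using that unfolding c_def cyclic_of_nat n by (simp add: le_mod_geq)
  have start: "c j = padded w ! (18 + j)" if "j < ?a + 18" "j < n" for j
    using that low high nth_padded_high[of j w] by simp
  \<comment> \<open>The window starts in the remainder, lies within the blocks, or runs past the end
    of the cyclic word.\<close>
  consider "m + 12 < n" "m < ?a" | "m + 12 < n" "?a \<le> m" | "n \<le> m + 12"
    by linarith
  then have "\<exists>t. t + 13 \<le> length (padded w) \<and> (\<forall>d<13. c (m + d) = padded w ! (t + d))"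
  proof cases
    case 1
    then show ?thesis
      using start by (intro exI[of _ "18 + m"]) (auto simp: add.assoc)
  next
    case 2
    define q where "q = (m - ?a) mod 6"
    have q: "q < 6" by (simp add: q_def)
    have "c (m + d) = padded w ! (18 + ?a + q + d)" if "d < 13" for d
    proof -
      have "c (m + d) = block ! ((m - ?a + d) mod 6)"
        using high[of "m + d"] 2 that by simp
      also have "(m - ?a + d) mod 6 = (q + d) mod 6"
        by (simp add: q_def mod_simps)
      also have "block ! \<dots> = padded w ! (18 + (?a + q + d))"
        using nth_padded_high[of "?a + q + d" w] q that by simp
      finally show ?thesis by (simp add: add.assoc)
    qed
    then show ?thesis
      using q by (intro exI[of _ "18 + ?a + q"]) simp
  next
    case 3
    \<comment> \<open>Index 18 of \<open>padded w\<close>, where the remainder starts, stands for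
      position \<open>n\<close> of the cyclic word. As \<open>k \<ge> 2\<close>, the at most 12
      entries before it all belong to blocks.\<close>
    have "c (m + d) = padded w ! (18 + m - n + d)" if "d < 13" for d
    proof (cases "m + d < n")
      case True
      have "c (m + d) = block ! ((m + d - ?a) mod 6)"
        using 3 True k by (intro high) (auto simp: n_def)
      also have "(m + d - ?a) mod 6 = (m + d - ?a + 6 * 3) mod 6"
        by (simp only: mod_mult_self2)
      also have "m + d - ?a + 6 * 3 = 18 + m - n + d + 6 * k"
        using 3 k by (simp add: n_def)
      also have "(18 + m - n + d + 6 * k) mod 6 = (18 + m - n + d) mod 6"
        by simp
      also have "block ! \<dots> = padded w ! (18 + m - n + d)"
        using True 3 by (intro nth_padded_low[symmetric]) simp
      finally show ?thesis .
    next
      case False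
      then have "c (m + d) = padded w ! (18 + (m + d - n))"
        using wrap[of "m + d"] start[of "m + d - n"] m that k by (simp add: n_def)
      also have "18 + (m + d - n) = 18 + m - n + d"
        using False 3 by simp
      finally show ?thesis .
    qed
    then show ?thesis
      using m by (intro exI[of _ "18 + m - n"]) auto
  qed
  then show ?thesis by (simp add: c_def)
qed

section \<open>From cyclic words to codes\<close>

definition code_of :: "bool list \<Rightarrow> int set" where
  "code_of w = int ` {j. j < length w \<and> w ! j}"

lemma card_code_of: "card (code_of w) = length (filter id w)"
  by (simp add: code_of_def card_image length_filter_conv_card)

lemma mem_code_of: "w \<noteq> [] \<Longrightarrow> i mod int (length w) \<in> code_of w \<longleftrightarrow> cyclic w i"
proof -
  assume "w \<noteq> []"
  define j where "j = nat (i mod int (length w))"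
  have "i mod int (length w) = int j" "j < length w"
    using \<open>w \<noteq> []\<close> by (simp_all add: j_def nat_less_iff)
  then show ?thesis
    by (auto simp: code_of_def cyclic_def)
qed

text \<open>An executable check independent of the number of blocks. The padded word has
  \<open>length w + 36\<close> entries, hence \<open>length w + 24\<close> windows of length
  13.\<close>

definition windows_ok :: "bool list \<Rightarrow> bool" where
  "windows_ok w \<longleftrightarrow>
    (\<forall>t\<in>set [0..<length w + 24]. locally_ld_window (take 13 (drop t (padded w))))"

lemma locally_ld_extend:
  assumes k: "k \<ge> 2"
    and win: "windows_ok w"
  shows "locally_ld (cyclic (extend w k))"
proof (rule locally_ldI)
  fix s :: int
  define n where "n = length w + 6 * k"
  have n: "length (extend w k) = n" "n > 0" using k by (simp_all add: length_extend n_def)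
  define m where "m = nat (s mod int n)"
  have m: "m < n" "int m = s mod int n"
    using n(2) by (simp_all add: m_def nat_less_iff)
  obtain t where t: "t + 13 \<le> length (padded w)"
    "\<And>d. d < 13 \<Longrightarrow> cyclic (extend w k) (int (m + d)) = padded w ! (t + d)"
    using window_extend_in_padded[OF k m(1)[unfolded n_def]] by blast
  have "cyclic (extend w k) (s + int d) = cyclic (extend w k) (int (m + d))" for d
    using cyclic_mod[of "extend w k" "s + int d"] cyclic_mod[of "extend w k" "int (m + d)"] m(2)
    by (simp add: n mod_simps)
  then have "map (\<lambda>d. cyclic (extend w k) (s + int d)) [0..<13] = take 13 (drop t (padded w))"
    using t by (intro nth_equalityI) simp_all
  then show "locally_ld_window (map (\<lambda>d. cyclic (extend w k) (s + int d)) [0..<13])"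
    using win t(1) by (simp add: windows_ok_def)
qed

lemma gamma_LD_circulant13_le:
  assumes k: "k \<ge> 2" and n: "n = length w + 6 * k" "n > 12"
    and win: "windows_ok w"
  shows "gamma_LD (circulant_verts n) (circulant13_adj n) \<le> length (filter id w) + 2 * k"
proof -
  let ?C = "code_of (extend w k)"
  have len: "length (extend w k) = n" "extend w k \<noteq> []"
    using k by (simp_all add: length_extend n(1) flip: length_greater_0_conv)
  have V: "finite (circulant_verts n)" "circulant_verts n \<noteq> {}"
    using n(2) by (simp_all add: circulant_verts_def)
  have "(\<lambda>i. i mod int n \<in> ?C) = cyclic (extend w k)"
    using mem_code_of[OF len(2)] len(1) by auto
  moreover have "locally_ld (cyclic (extend w k))"
    by (rule locally_ld_extend[OF k win])
  moreover have "?C \<subseteq> circulant_verts n"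
    using len(1) by (auto simp: code_of_def circulant_verts_def)
  ultimately have "locating_dominating (circulant_verts n) (circulant13_adj n) ?C"
    using locating_dominating_iff_locally_ld[OF n(2)] by simp
  then have "gamma_LD (circulant_verts n) (circulant13_adj n) \<le> card ?C"
    by (rule gamma_LD_attained(2)[OF V])
  also have "card ?C = length (filter id w) + 2 * k"
    by (simp add: card_code_of extend_def filter_concat length_concat sum_list_replicate)
       (simp add: block_def)
  finally show ?thesis .
qed
text \<open>One remainder for each residue 0, ..., 5 modulo 6, with 0, 3, 2, 2, 2, 3 codewords.
  Residue 1 is realised with length 7.\<close>

lemma windows_ok_remainders:
  "windows_ok []"
  "windows_ok [True, True, False, False, True, False, False]"
  "windows_ok [True, True]"
  "windows_ok [True, True, False]"
  "windows_ok [True, True, False, False]"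
  "windows_ok [True, True, False, False, True]"
  by code_simp+

section \<open>The bounds combined\<close>

lemma gamma_LD_circulant13_ge:
  assumes n: "n > 17"
  shows "n + (if 6 dvd n then 0 else 2) \<le> 3 * gamma_LD (circulant_verts n) (circulant13_adj n)"
proof -
  have V: "finite (circulant_verts n)" "circulant_verts n \<noteq> {}"
    using n by (simp_all add: circulant_verts_def)
  obtain C where C: "locating_dominating (circulant_verts n) (circulant13_adj n) C"
    and card_C: "card C = gamma_LD (circulant_verts n) (circulant13_adj n)"
    using gamma_LD_attained(1)[OF V] by blast
  have sub: "C \<subseteq> circulant_verts n"
    using C by (simp add: locating_dominating_def)
  define x where "x i \<longleftrightarrow> i mod int n \<in> C" for i
  have "locally_ld x"
    using C n sub locating_dominating_iff_locally_ld[of n C] unfolding x_def by simp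
  moreover have "x (i + int n) = x i" for i
    by (simp add: x_def)
  ultimately have "n + (if 6 dvd n then 0 else 2) \<le> 3 * card {i. i < n \<and> x (int i)}"
    using n by (rule periodic_card_ge)
  moreover have "C = int ` {i. i < n \<and> x (int i)}"
  proof (intro equalityI subsetI)
    fix c assume c: "c \<in> C"
    then have "0 \<le> c" "c < int n"
      using sub by (auto simp: circulant_verts_def)
    then show "c \<in> int ` {i. i < n \<and> x (int i)}"
      using c by (intro image_eqI[of _ _ "nat c"]) (auto simp: x_def)
  qed (auto simp: x_def)
  ultimately show ?thesis
    using card_C by (simp add: card_image)
qed

text \<open>For \<open>n\<close> not divisible by 6 the lower bound is (n + 2)/3 rounded up. This
  exceeds n/3 rounded up, by one, exactly for the residues 2, 3 and 5, and the constructed codes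
  attain it.\<close>

theorem theorem10:
  fixes n :: nat
  assumes "n > 17"
  shows "int (gamma_LD (circulant_verts n) (circulant13_adj n)) =
    (if n mod 6 \<in> {0, 1, 4} then \<lceil>real n / 3\<rceil> else \<lceil>real n / 3\<rceil> + 1)"
proof -
  define g where "g = gamma_LD (circulant_verts n) (circulant13_adj n)"
  have ge: "n + (if 6 dvd n then 0 else 2) \<le> 3 * g"
    unfolding g_def by (rule gamma_LD_circulant13_ge[OF assms])
  have le: "g \<le> length (filter id w) + 2 * k"
    if "n = length w + 6 * k" "k \<ge> 2" "windows_ok w" for w k
    unfolding g_def using that assms by (intro gamma_LD_circulant13_le) auto
  have ceil: "\<lceil>real n / 3\<rceil> = m" if "int n \<le> 3 * m" "3 * m < int n + 3" for m
    using that by (intro ceiling_unique) (simp_all add: field_simps flip: of_int_less_iff[where 'a=real] of_int_le_iff[where 'a=real])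
  define q where "q = n div 6"
  have q: "n = 6 * q + n mod 6" "q \<ge> 3"
    using assms by (simp_all add: q_def)
  have "n mod 6 < 6" by simp
  then consider "n mod 6 = 0" | "n mod 6 = 1" | "n mod 6 = 2" | "n mod 6 = 3" | "n mod 6 = 4" | "n mod 6 = 5"
    by linarith
  then show ?thesis
  proof cases
    case 1
    have "g \<le> 2 * q"
      using le[of "[]" q] windows_ok_remainders(1) q 1 by simp
    then have "g = 2 * q" using ge q 1 by (simp split: if_splits)
    moreover have "\<lceil>real n / 3\<rceil> = int (2 * q)" using q 1 by (intro ceil) auto
    ultimately show ?thesis using 1 by (simp flip: g_def)
  next
    case 2
    \<comment> \<open>The remainder of length 7 absorbs one block, leaving \<open>q - 1\<close>
      blocks; \<open>q \<ge> 3\<close> ensures that these are at least two.\<close>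
    obtain p where p: "q = Suc p" using q(2) by (cases q) auto
    have "g \<le> 2 * q + 1"
      using le[of "[True, True, False, False, True, False, False]" p]
        windows_ok_remainders(2) q 2 p by simp
    moreover have "\<not> 6 dvd n" using 2 by auto
    ultimately have "g = 2 * q + 1" using ge q 2 by simp
    moreover have "\<lceil>real n / 3\<rceil> = int (2 * q + 1)" using q 2 by (intro ceil) auto
    ultimately show ?thesis using 2 by (simp flip: g_def)
  next
    case 3
    have "g \<le> 2 * q + 2"
      using le[of "[True, True]" q] windows_ok_remainders(3) q 3 by simp
    moreover have "\<not> 6 dvd n" using 3 by auto
    ultimately have "g = 2 * q + 2" using ge q 3 by simp
    moreover have "\<lceil>real n / 3\<rceil> = int (2 * q + 1)" using q 3 by (intro ceil) auto
    ultimately show ?thesis using 3 by (simp flip: g_def)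
  next
    case 4
    have "g \<le> 2 * q + 2"
      using le[of "[True, True, False]" q] windows_ok_remainders(4) q 4 by simp
    moreover have "\<not> 6 dvd n" using 4 by auto
    ultimately have "g = 2 * q + 2" using ge q 4 by simp
    moreover have "\<lceil>real n / 3\<rceil> = int (2 * q + 1)" using q 4 by (intro ceil) auto
    ultimately show ?thesis using 4 by (simp flip: g_def)
  next
    case 5
    have "g \<le> 2 * q + 2"
      using le[of "[True, True, False, False]" q] windows_ok_remainders(5) q 5 by simp
    moreover have "\<not> 6 dvd n" using 5 by auto
    ultimately have "g = 2 * q + 2" using ge q 5 by simp
    moreover have "\<lceil>real n / 3\<rceil> = int (2 * q + 2)" using q 5 by (intro ceil) auto
    ultimately show ?thesis using 5 by (simp flip: g_def)
  next
    case 6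
    have "g \<le> 2 * q + 3"
      using le[of "[True, True, False, False, True]" q] windows_ok_remainders(6) q 6 by simp
    moreover have "\<not> 6 dvd n" using 6 by auto
    ultimately have "g = 2 * q + 3" using ge q 6 by simp
    moreover have "\<lceil>real n / 3\<rceil> = int (2 * q + 2)" using q 6 by (intro ceil) auto
    ultimately show ?thesis using 6 by (simp flip: g_def)
  qed
qed

end
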